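(* Let $r\in\mathbb Z$ and $W\in\mathcal W_\psi$. If $W$ is (right) $\mathbf N_3(\mathfrak p^{-r})$-invariant, then $$Z(s,W)=\Xi\left(s,\int_{\bar{\mathbf N}'(\mathfrak p^r)}\pi(\bar n)W\,d\bar n\right),$$ where $\pi$ denotes right translation. In particular, $Z(s,W)=q^{-r}\,\Xi(s,W)$ if $W$ is additionally (right) $\bar{\mathbf N}'(\mathfrak p^r)$-invariant.
   Context: $F$ is a non-archimedean local field of characteristic $0$, with ring of integers $\mathfrak o$, maximal ideal $\mathfrak p=\varpi\mathfrak o$, $q=|\mathfrak o/\mathfrak p|$, $|\varpi|=q^{-1}$. $\psi:F\to\mathbb C^1$ is a continuous homomorphism with $\psi(\mathfrak o)=1$, $\psi(\mathfrak p^{-1})\neq1$. $\mathbf G=GSp(4,F)$ is the group of similitudes of the form given by $J=\begin{bmatrix}0&0&0&-1\\0&0&-1&0\\0&1&0&0\\1&0&0&0\end{bmatrix}$. $\mathcal W_\psi$ is the space of smooth functions $W:\mathbf G\to\mathbb C$ with $W(ng)=\psi(x+y)W(g)$ for all upper triangular unipotent $n=\begin{bmatrix}1&-x&*&*\\0&1&y&*\\0&0&1&x\\0&0&0&1\end{bmatrix}\in\mathbf G$; $\mathbf G$ acts by right translation. $\mathbf N_3(\mathfrak p^{-r})$ is the group of matrices $\mathbf n_3(x)=\begin{bmatrix}1&0&x&0\\0&1&0&x\\0&0&1&0\\0&0&0&1\end{bmatrix}$, $x\in\mathfrak p^{-r}$. $\bar{\mathbf N}'$ is the group of matrices $\bar{\mathbf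 n}'(x)=\begin{bmatrix}1&0&0&0\\0&1&0&0\\0&x&1&0\\0&0&0&1\end{bmatrix}$, $x\in F$, and $\bar{\mathbf N}'(\mathfrak p^r)$ the subgroup with $x\in\mathfrak p^r$; the Haar measure $d\bar n$ on $\bar{\mathbf N}'$ gives $\bar{\mathbf N}'(\mathfrak o)$ volume $1$. With $\mathbf a'(t)=\mathrm{diag}(t,t,1,1)$ and $d^\times t$ the Haar measure on $F^\times$ with $\mathrm{vol}(\mathfrak o^\times)=1$, $$\Xi(s,W)=\int_{F^\times}W(\mathbf a'(t))|t|^{s-\frac32}d^\times t,\qquad Z(s,W)=\Xi\left(s,\int_{\bar{\mathbf N}'}\pi(\bar n)W\,d\bar n\right),$$ the integrals being understood where they converge. *)

theory Defs
  imports "HOL-Analysis.Analysis"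
begin

section \<open>Non-archimedean local fields of characteristic 0\<close>

class abs_value = minus + times +
  fixes vabs :: "'a \<Rightarrow> real"
begin

definition int_ring :: "'a set" where
  "int_ring = {x. vabs x \<le> 1}"

definition max_ideal :: "'a set" where
  "max_ideal = {x. vabs x < 1}"

definition residue_field :: "'a set set" where
  "residue_field = int_ring // {(x, y). x \<in> int_ring \<and> y \<in> int_ring \<and> x - y \<in> max_ideal}"

definition residue_card :: "'a itself \<Rightarrow> nat" where
  "residue_card _ = card residue_field"

definition uniformizer :: "'a \<Rightarrow> bool" where
  "uniformizer w \<longleftrightarrow> max_ideal = {w * y |y. y \<in> int_ring}"

end

text \<open>
  A field of characteristic 0, complete for a discrete absolute value with finite residue field,
  the absolute value being normalized by \<open>\<bar>w\<bar> = 1/q\<close> for a uniformizer \<open>w\<close>.  The metric (hence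
  the topology and the Borel sets) is the one of the absolute value; together with \<open>dist_vabs\<close>
  the metric axioms make \<open>vabs\<close> nonnegative and definite.  The absolute value is nontrivial:
  \<open>q\<close> is at least 2 because 0 and 1 have different residue classes, so \<open>w\<close> is nonzero.
\<close>

class nonarch_local_field = field_char_0 + complete_space + abs_value +
  assumes dist_vabs: "dist x y = vabs (x - y)"
    and vabs_mult: "vabs (x * y) = vabs x * vabs y"
    and vabs_ultrametric: "vabs (x + y) \<le> max (vabs x) (vabs y)"
    and finite_residue_field: "finite residue_field"
    and normalized_uniformizer:
      "\<exists>w. uniformizer w \<and> vabs w = 1 / real (residue_card TYPE('a))"

definition int_units :: "'a::nonarch_local_field set" where
  "int_units = {x \<in> int_ring. \<exists>y \<in> int_ring. x * y = 1}"

definition frac_ideal :: "'a::nonarch_local_field \<Rightarrow> int \<Rightarrow> 'a set" where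
  "frac_ideal w k = {w powi k * y |y. y \<in> int_ring}"

definition unramified_character :: "('a::nonarch_local_field \<Rightarrow> complex) \<Rightarrow> 'a \<Rightarrow> bool" where
  "unramified_character \<psi> w \<longleftrightarrow>
     continuous_on UNIV \<psi> \<and>
     (\<forall>x y. \<psi> (x + y) = \<psi> x * \<psi> y) \<and>
     (\<forall>x. norm (\<psi> x) = 1) \<and>
     (\<forall>x \<in> int_ring. \<psi> x = 1) \<and>
     (\<exists>x \<in> frac_ideal w (-1). \<psi> x \<noteq> 1)"


section \<open>Haar measure\<close>

text \<open>
  Left Haar measure on a topological group given by its carrier \<open>G\<close> (with the subspace topology)
  and its multiplication \<open>m\<close>.  No regularity is required: it is automatic for the second countable
  locally compact groups considered here.
\<close>

definition haar_measure ::
    "'g::topological_space set \<Rightarrow> ('g \<Rightarrow> 'g \<Rightarrow> 'g) \<Rightarrow> 'g measure \<Rightarrow> bool" where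
  "haar_measure G m M \<longleftrightarrow>
     space M = G \<and>
     sets M = sets (restrict_space borel G) \<and>
     (\<forall>g \<in> G. \<forall>A \<in> sets M. emeasure M (m g ` A) = emeasure M A) \<and>
     (\<forall>K. compact K \<longrightarrow> K \<subseteq> G \<longrightarrow> emeasure M K < \<infinity>) \<and>
     emeasure M G \<noteq> 0"


section \<open>The group GSp(4) and its subgroups\<close>

definition mat4 :: "'a::zero list list \<Rightarrow> 'a^4^4" where
  "mat4 ls = vector (map vector ls)"

definition J4 :: "'a::nonarch_local_field^4^4" where
  "J4 = mat4 [[0, 0,  0, -1],
              [0, 0, -1,  0],
              [0, 1,  0,  0],
              [1, 0,  0,  0]]"

definition GSp4 :: "('a::nonarch_local_field^4^4) set" where
  "GSp4 = {g. invertible g \<and> (\<exists>l. l \<noteq> 0 \<and> transpose g ** J4 ** g = mat l ** J4)}"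

text \<open>The entries \<open>a\<close>, \<open>b\<close>, \<open>c\<close> are those written as stars.\<close>

definition upper_unip ::
    "'a \<Rightarrow> 'a \<Rightarrow> 'a \<Rightarrow> 'a \<Rightarrow> 'a \<Rightarrow> 'a::nonarch_local_field^4^4" where
  "upper_unip x y a b c = mat4 [[1, -x, a, b],
                                [0,  1, y, c],
                                [0,  0, 1, x],
                                [0,  0, 0, 1]]"

definition n3 :: "'a \<Rightarrow> 'a::nonarch_local_field^4^4" where
  "n3 x = mat4 [[1, 0, x, 0],
                [0, 1, 0, x],
                [0, 0, 1, 0],
                [0, 0, 0, 1]]"

definition nbar :: "'a \<Rightarrow> 'a::nonarch_local_field^4^4" where
  "nbar x = mat4 [[1, 0, 0, 0],
                  [0, 1, 0, 0],
                  [0, x, 1, 0],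
                  [0, 0, 0, 1]]"

definition a_prime :: "'a \<Rightarrow> 'a::nonarch_local_field^4^4" where
  "a_prime t = mat4 [[t, 0, 0, 0],
                     [0, t, 0, 0],
                     [0, 0, 1, 0],
                     [0, 0, 0, 1]]"


section \<open>Whittaker functions and zeta integrals\<close>

text \<open>
  Functions on \<open>GSp4\<close> are represented by functions on all matrices, of which only the values
  on \<open>GSp4\<close> are used.  Smooth means locally constant.
\<close>

definition smooth_on_GSp4 :: "('a::nonarch_local_field^4^4 \<Rightarrow> complex) \<Rightarrow> bool" where
  "smooth_on_GSp4 W \<longleftrightarrow>
     (\<forall>g \<in> GSp4. \<exists>U. open U \<and> g \<in> U \<and> (\<forall>h \<in> U \<inter> GSp4. W h = W g))"

definition whittaker_space ::
    "('a::nonarch_local_field \<Rightarrow> complex) \<Rightarrow> ('a^4^4 \<Rightarrow> complex) set" where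
  "whittaker_space \<psi> = {W. smooth_on_GSp4 W \<and>
     (\<forall>x y a b c. upper_unip x y a b c \<in> GSp4 \<longrightarrow>
        (\<forall>g \<in> GSp4. W (upper_unip x y a b c ** g) = \<psi> (x + y) * W g))}"

definition right_invariant ::
    "('a::nonarch_local_field^4^4) set \<Rightarrow> ('a^4^4 \<Rightarrow> complex) \<Rightarrow> bool" where
  "right_invariant H W \<longleftrightarrow> (\<forall>g \<in> GSp4. \<forall>h \<in> H. W (g ** h) = W g)"

definition right_transl ::
    "'a::nonarch_local_field^4^4 \<Rightarrow> ('a^4^4 \<Rightarrow> complex) \<Rightarrow> ('a^4^4 \<Rightarrow> complex)" where
  "right_transl h W = (\<lambda>g. W (g ** h))"

text \<open>\<open>transl_integral \<mu> S W\<close> is the integral of \<open>\<pi>(n)W\<close> over \<open>n \<in> S\<close>, taken pointwise on the group.\<close>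

definition transl_integral ::
    "('a::nonarch_local_field^4^4) measure \<Rightarrow> ('a^4^4) set \<Rightarrow> ('a^4^4 \<Rightarrow> complex)
       \<Rightarrow> ('a^4^4 \<Rightarrow> complex)" where
  "transl_integral \<mu> S W = (\<lambda>g. LINT n:S|\<mu>. right_transl n W g)"

definition Xi_integrand ::
    "complex \<Rightarrow> ('a::nonarch_local_field^4^4 \<Rightarrow> complex) \<Rightarrow> 'a \<Rightarrow> complex" where
  "Xi_integrand s W t = W (a_prime t) * complex_of_real (vabs t) powr (s - 3 / 2)"

text \<open>
  The Bochner integral is 0 where it does not converge, so the convergence of the integrals
  is kept as separate predicates.
\<close>

definition Xi_converges ::
    "'a::nonarch_local_field measure \<Rightarrow> complex \<Rightarrow> ('a^4^4 \<Rightarrow> complex) \<Rightarrow> bool" where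
  "Xi_converges \<nu> s W \<longleftrightarrow> integrable \<nu> (Xi_integrand s W)"

definition Xi ::
    "'a::nonarch_local_field measure \<Rightarrow> complex \<Rightarrow> ('a^4^4 \<Rightarrow> complex) \<Rightarrow> complex" where
  "Xi \<nu> s W = (LINT t|\<nu>. Xi_integrand s W t)"

text \<open>
  \<open>\<Xi>\<close> only evaluates its argument at the elements \<open>a_prime t\<close>, so convergence of the
  inner integral is required at these elements only.
\<close>

definition Z_converges ::
    "('a::nonarch_local_field^4^4) measure \<Rightarrow> 'a measure \<Rightarrow> complex
       \<Rightarrow> ('a^4^4 \<Rightarrow> complex) \<Rightarrow> bool" where
  "Z_converges \<mu> \<nu> s W \<longleftrightarrow>
     (\<forall>t. t \<noteq> 0 \<longrightarrow> set_integrable \<mu> (range nbar) (\<lambda>n. right_transl n W (a_prime t))) \<and>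
     Xi_converges \<nu> s (transl_integral \<mu> (range nbar) W)"

definition Z ::
    "('a::nonarch_local_field^4^4) measure \<Rightarrow> 'a measure \<Rightarrow> complex
       \<Rightarrow> ('a^4^4 \<Rightarrow> complex) \<Rightarrow> complex" where
  "Z \<mu> \<nu> s W = Xi \<nu> s (transl_integral \<mu> (range nbar) W)"

end

theory Submission
  imports Defs
begin

text \<open>
  The identity
  \<open>a_prime t ** nbar x ** n3 y = upper_unip (x * y) 0 (t * y) 0 (t * y) ** (a_prime t ** nbar x)\<close>
  shows that, for \<open>y\<close> in the ideal of exponent \<open>-r\<close>, the value \<open>W (a_prime t ** nbar x)\<close> is multiplied by
  \<open>\<psi> (x * y)\<close> and yet unchanged.  When \<open>x\<close> is not in the ideal of exponent \<open>r\<close>, the products \<open>x * y\<close>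
  fill at least the ideal of exponent \<open>-1\<close>, on which \<open>\<psi>\<close> is nontrivial, so the value is \<open>0\<close> and only the part
  of the inner integral over that ideal survives.  It converges because the integrand is locally constant
  and the ideal is compact; the factor \<open>q powi (- r)\<close> is the volume of the ideal, computed by splitting
  each ideal into \<open>q\<close> translates of the next one.
\<close>

section \<open>The absolute value and the fractional ideals\<close>

text \<open>\<open>vabs x\<close> is the distance from \<open>x\<close> to 0, so nonnegativity,
  definiteness and invariance under sign change come from the metric axioms.\<close>

lemma vabs_zero [simp]: "vabs (0::'a::nonarch_local_field) = 0"
  using dist_vabs[of "0::'a" 0] by simp

lemma vabs_nonneg [simp]: "vabs (x::'a::nonarch_local_field) \<ge> 0"
  using dist_vabs[of x 0] zero_le_dist[of x 0] by simp

lemma vabs_eq_0_iff [simp]: "vabs (x::'a::nonarch_local_field) = 0 \<longleftrightarrow> x = 0"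
  using dist_vabs[of x 0] dist_eq_0_iff[of x 0] by simp

lemma vabs_pos [simp]: "0 < vabs (x::'a::nonarch_local_field) \<longleftrightarrow> x \<noteq> 0"
  using vabs_nonneg[of x] vabs_eq_0_iff[of x] by linarith

lemma vabs_one [simp]: "vabs (1::'a::nonarch_local_field) = 1"
  using vabs_mult[of 1 "1::'a"] by (simp add: field_simps)

lemma vabs_minus [simp]: "vabs (- x::'a::nonarch_local_field) = vabs x"
  using dist_vabs[of 0 x] dist_vabs[of x 0] by (simp add: dist_commute)

lemma vabs_inverse: "vabs (inverse (x::'a::nonarch_local_field)) = inverse (vabs x)"
proof (cases "x = 0")
  case False
  then have "vabs x * vabs (inverse x) = 1"
    by (simp flip: vabs_mult)
  then show ?thesis
    by (metis inverse_unique)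
qed simp

lemma vabs_divide: "vabs (x / y::'a::nonarch_local_field) = vabs x / vabs y"
  by (simp add: divide_inverse vabs_mult vabs_inverse)

lemma vabs_power: "vabs (x ^ n::'a::nonarch_local_field) = vabs x ^ n"
  by (induction n) (simp_all add: vabs_mult)

lemma vabs_powi: "vabs (x powi k::'a::nonarch_local_field) = vabs x powi k"
  by (simp add: power_int_def vabs_power vabs_inverse)

section \<open>Residue classes and the absolute value of a uniformizer\<close>

abbreviation residue_rel :: "('a::nonarch_local_field \<times> 'a) set" where
  "residue_rel \<equiv> {(x, y). x \<in> int_ring \<and> y \<in> int_ring \<and> x - y \<in> max_ideal}"

lemma equiv_residue_rel: "equiv int_ring (residue_rel :: ('a::nonarch_local_field \<times> 'a) set)"
proof (rule equivI)
  show "refl_on int_ring (residue_rel :: ('a \<times> 'a) set)"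
    by (auto simp: refl_on_def max_ideal_def)
  show "sym (residue_rel :: ('a \<times> 'a) set)"
  proof (rule symI)
    fix x y :: 'a
    assume "(x, y) \<in> residue_rel"
    then show "(y, x) \<in> residue_rel"
      using vabs_minus[of "x - y"] by (auto simp: max_ideal_def)
  qed
  show "trans (residue_rel :: ('a \<times> 'a) set)"
  proof (rule transI)
    fix x y z :: 'a
    assume "(x, y) \<in> residue_rel" "(y, z) \<in> residue_rel"
    then show "(x, z) \<in> residue_rel"
      using vabs_ultrametric[of "x - y" "y - z"] by (auto simp: max_ideal_def)
  qed
qed auto

text \<open>The classes of 0 and 1 differ because \<open>vabs 1 = 1\<close>. The bound makes the
  powers of \<open>q\<close> positive and strictly monotone.\<close>

lemma residue_card_ge_2: "residue_card TYPE('a::nonarch_local_field) \<ge> 2"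
proof -
  let ?X = "\<lambda>x::'a. residue_rel `` {x}"
  have "?X 1 \<noteq> ?X 0"
    using eq_equiv_class[OF _ equiv_residue_rel, of 1 "0::'a"]
    by (auto simp: int_ring_def max_ideal_def)
  moreover have "{?X 0, ?X 1} \<subseteq> residue_field"
    unfolding residue_field_def insert_subset
    by (intro conjI quotientI) (simp_all add: int_ring_def)
  ultimately have "card {?X 0, ?X 1} \<le> card (residue_field :: 'a set set)"
    by (intro card_mono finite_residue_field)
  moreover have "card {?X 0, ?X 1} = 2"
    by (rule card_2_iff[THEN iffD2, OF exI, OF exI, OF conjI, OF refl]) (rule \<open>?X 1 \<noteq> ?X 0\<close>[symmetric])
  ultimately show ?thesis
    unfolding residue_card_def by linarith
qed

text \<open>The class axiom normalizes only one uniformizer. Any two divide each other in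
  \<open>int_ring\<close>, so all have the same absolute value.\<close>

lemma vabs_uniformizer:
  assumes "uniformizer (w::'a::nonarch_local_field)"
  shows "vabs w = 1 / real (residue_card TYPE('a))"
proof -
  have le: "vabs u \<le> vabs v" if "uniformizer u" "uniformizer v" for u v :: 'a
  proof -
    have "u \<in> max_ideal"
      using that(1) unfolding uniformizer_def by (auto simp: int_ring_def intro!: exI[of _ 1])
    then obtain y where "u = v * y" "vabs y \<le> 1"
      using \<open>uniformizer v\<close> unfolding uniformizer_def by (auto simp: int_ring_def)
    then show ?thesis
      by (simp add: vabs_mult mult_left_le)
  qed
  obtain w' :: 'a where "uniformizer w'" "vabs w' = 1 / real (residue_card TYPE('a))"
    using normalized_uniformizer by blast
  then show ?thesis
    using le[of w w'] le[of w' w] assms by simp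
qed

lemma uniformizer_nonzero: "uniformizer (w::'a::nonarch_local_field) \<Longrightarrow> w \<noteq> 0"
  using vabs_uniformizer[of w] residue_card_ge_2[where 'a='a] by auto

section \<open>Fractional ideals as closed balls\<close>

lemma vabs_uniformizer_powi:
  "uniformizer (w::'a::nonarch_local_field) \<Longrightarrow>
    vabs (w powi k) = real (residue_card TYPE('a)) powi - k"
  by (simp add: vabs_powi vabs_uniformizer power_int_minus power_int_divide_distrib
      divide_inverse power_int_inverse)

lemma frac_ideal_iff:
  assumes "uniformizer (w::'a::nonarch_local_field)"
  shows "x \<in> frac_ideal w k \<longleftrightarrow> vabs x \<le> real (residue_card TYPE('a)) powi - k"
proof
  assume "x \<in> frac_ideal w k"
  then obtain y where "x = w powi k * y" "vabs y \<le> 1"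
    unfolding frac_ideal_def int_ring_def by blast
  then show "vabs x \<le> real (residue_card TYPE('a)) powi - k"
    using assms by (simp add: vabs_mult vabs_uniformizer_powi mult_left_le)
next
  assume *: "vabs x \<le> real (residue_card TYPE('a)) powi - k"
  define u where "u = w powi k"
  have u: "u \<noteq> 0" "vabs u = real (residue_card TYPE('a)) powi - k"
    using uniformizer_nonzero[OF assms] vabs_uniformizer_powi[OF assms] by (simp_all add: u_def)
  have "vabs (x / u) \<le> 1"
    using * u vabs_pos[of u] by (simp add: vabs_divide divide_le_eq_1)
  then show "x \<in> frac_ideal w k"
    unfolding frac_ideal_def int_ring_def u_def[symmetric] using u(1)
    by (auto intro!: exI[of _ "x / u"])
qed

lemma frac_ideal_scale:
  assumes "uniformizer (w::'a::nonarch_local_field)"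
  shows "w powi k * x \<in> frac_ideal w (k + m) \<longleftrightarrow> x \<in> frac_ideal w m"
proof -
  let ?q = "real (residue_card TYPE('a))"
  have q: "?q \<noteq> 0" "?q powi - k > 0"
    using residue_card_ge_2[where 'a='a] by (auto intro: zero_less_power_int)
  have "?q powi - (k + m) = ?q powi - k * ?q powi - m"
    using q(1) by (simp flip: power_int_add)
  then show ?thesis
    using q(2) by (simp only: frac_ideal_iff[OF assms] vabs_mult vabs_uniformizer_powi[OF assms]
        mult_le_cancel_left_pos)
qed

lemma frac_ideal_0: "frac_ideal w 0 = (int_ring :: 'a::nonarch_local_field set)"
  by (auto simp: frac_ideal_def)

lemma frac_ideal_1: "uniformizer w \<Longrightarrow> frac_ideal w 1 = (max_ideal :: 'a::nonarch_local_field set)"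
  by (simp add: frac_ideal_def uniformizer_def)

text \<open>The absolute value is discrete: no value lies strictly between
  \<open>q powi - (k + 1)\<close> and \<open>q powi - k\<close>. For \<open>k = 0\<close> this is
  the defining property of a uniformizer; division by \<open>w powi k\<close> reduces to that
  case.\<close>

lemma vabs_less_imp_frac_ideal:
  assumes "uniformizer (w::'a::nonarch_local_field)"
    and "vabs x < real (residue_card TYPE('a)) powi - k"
  shows "x \<in> frac_ideal w (k + 1)"
proof -
  define u where "u = w powi k"
  have u: "u \<noteq> 0" "vabs u = real (residue_card TYPE('a)) powi - k"
    using uniformizer_nonzero[OF assms(1)] vabs_uniformizer_powi[OF assms(1)] by (simp_all add: u_def)
  have "vabs (x / u) < 1"
    using assms(2) u vabs_pos[of u] by (simp add: vabs_divide divide_less_eq_1)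
  then have "x / u \<in> frac_ideal w 1"
    by (simp add: frac_ideal_1[OF assms(1)] max_ideal_def)
  then show ?thesis
    using frac_ideal_scale[OF assms(1), of k "x / u" 1] u(1) by (simp flip: u_def)
qed

lemma frac_ideal_add:
  assumes "uniformizer (w::'a::nonarch_local_field)" "x \<in> frac_ideal w k" "y \<in> frac_ideal w k"
  shows "x + y \<in> frac_ideal w k"
  using assms vabs_ultrametric[of x y] by (simp add: frac_ideal_iff)

lemma frac_ideal_mono:
  assumes "uniformizer (w::'a::nonarch_local_field)" "k \<le> m"
  shows "frac_ideal w m \<subseteq> frac_ideal w k"
  using residue_card_ge_2[where 'a='a] power_int_increasing[of "- m" "- k" "real (residue_card TYPE('a))"] assms
  by (auto simp: frac_ideal_iff)

section \<open>Coset representatives and finite covers\<close>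

lemma int_ring_representatives:
  obtains C where "C \<subseteq> (int_ring :: 'a::nonarch_local_field set)" "finite C"
    "card C = residue_card TYPE('a)"
    "\<And>x. x \<in> int_ring \<Longrightarrow> \<exists>!c. c \<in> C \<and> x - c \<in> max_ideal"
proof -
  let ?F = "residue_field :: 'a set set"
  define rep where "rep = (\<lambda>X. SOME x::'a. x \<in> X)"
  have rep: "rep X \<in> X" if "X \<in> ?F" for X
    using in_quotient_imp_non_empty[OF equiv_residue_rel] that
    unfolding rep_def residue_field_def by (auto simp: some_in_eq)
  have rep_int: "rep X \<in> int_ring" if "X \<in> ?F" for X
    using in_quotient_imp_subset[OF equiv_residue_rel] that rep[OF that]
    unfolding residue_field_def by blast
  \<comment> \<open>An integer congruent to the chosen representative determines the class. This
    yields both the injectivity of \<open>rep\<close> and the uniqueness of the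
    representative.\<close>
  have class_eq: "residue_rel `` {x} = X" if X: "X \<in> ?F" and x: "x \<in> int_ring" "x - rep X \<in> max_ideal" for X x
  proof -
    obtain a where a: "X = residue_rel `` {a}"
      using X unfolding residue_field_def by (rule quotientE)
    have "(a, rep X) \<in> residue_rel"
      using rep[OF that(1)] a by blast
    moreover have "(rep X, x) \<in> residue_rel"
      using that rep_int[OF that(1)] vabs_minus[of "x - rep X"] by (auto simp: max_ideal_def)
    ultimately have "(a, x) \<in> residue_rel"
      using equiv_residue_rel unfolding equiv_def by (blast dest: transD)
    then show ?thesis
      unfolding a by (rule equiv_class_eq[OF equiv_residue_rel, symmetric])
  qed
  have inj: "inj_on rep ?F"
  proof (rule inj_onI)
    fix X Y assume "X \<in> ?F" "Y \<in> ?F" "rep X = rep Y"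
    then show "X = Y"
      using class_eq[of X "rep X"] class_eq[of Y "rep X"] rep_int[of X] by (simp add: max_ideal_def)
  qed
  have "\<exists>!c. c \<in> rep ` ?F \<and> x - c \<in> max_ideal" if x: "x \<in> int_ring" for x
  proof (rule ex1I)
    let ?X = "residue_rel `` {x}"
    have X: "?X \<in> ?F"
      using x unfolding residue_field_def by (rule quotientI)
    then show "rep ?X \<in> rep ` ?F \<and> x - rep ?X \<in> max_ideal"
      using rep[OF X] by auto
    show "c = rep ?X" if "c \<in> rep ` ?F \<and> x - c \<in> max_ideal" for c
      using that class_eq x by auto
  qed
  moreover have "rep ` ?F \<subseteq> int_ring"
    using rep_int by blast
  ultimately show ?thesis
    using card_image[OF inj] finite_imageI[OF finite_residue_field, of rep]
    by (intro that[of "rep ` ?F"]) (simp_all add: residue_card_def)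
qed

text \<open>Multiplication by \<open>w powi k\<close> carries representatives of the residue classes
  to representatives of the successive quotient at level \<open>k\<close>. Existence gives coverings
  by cosets, uniqueness their disjointness.\<close>

lemma frac_ideal_representatives:
  assumes w: "uniformizer (w::'a::nonarch_local_field)"
  obtains C where "C \<subseteq> frac_ideal w k" "finite C" "card C = residue_card TYPE('a)"
    "\<And>x. x \<in> frac_ideal w k \<Longrightarrow> \<exists>!c. c \<in> C \<and> x - c \<in> frac_ideal w (k + 1)"
proof -
  define u where "u = w powi k"
  have u: "u \<noteq> 0"
    using uniformizer_nonzero[OF w] by (simp add: u_def)
  obtain C :: "'a set" where C: "C \<subseteq> int_ring" "finite C" "card C = residue_card TYPE('a)"
    "\<And>x. x \<in> int_ring \<Longrightarrow> \<exists>!c. c \<in> C \<and> x - c \<in> max_ideal"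
    by (rule int_ring_representatives) (rule that)
  show ?thesis
  proof (rule that)
    show "(*) u ` C \<subseteq> frac_ideal w k"
      using C(1) by (auto simp: frac_ideal_def u_def)
    show "finite ((*) u ` C)"
      using C(2) by simp
    show "card ((*) u ` C) = residue_card TYPE('a)"
      using C(3) u by (simp add: card_image inj_on_def)
    fix x assume "x \<in> frac_ideal w k"
    then obtain y where y: "x = u * y" "y \<in> int_ring"
      by (auto simp: frac_ideal_def u_def)
    have *: "x - u * c \<in> frac_ideal w (k + 1) \<longleftrightarrow> y - c \<in> max_ideal" for c
      using frac_ideal_scale[OF w, of k "y - c" 1]
      by (simp add: y(1) u_def frac_ideal_1[OF w] right_diff_distrib)
    show "\<exists>!c. c \<in> (*) u ` C \<and> x - c \<in> frac_ideal w (k + 1)"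
      using C(4)[OF y(2)] * by (auto simp: Ex1_def)
  qed
qed

text \<open>Refine one level at a time: if \<open>S\<close> works for \<open>n\<close>, the sums of
  elements of \<open>S\<close> and of representatives at level \<open>k + n\<close> work for
  \<open>n + 1\<close>.\<close>

lemma frac_ideal_finite_cover:
  assumes w: "uniformizer (w::'a::nonarch_local_field)"
  shows "\<exists>S. finite S \<and> (\<forall>x \<in> frac_ideal w k. \<exists>c \<in> S. x - c \<in> frac_ideal w (k + int n))"
proof (induction n)
  case 0
  then show ?case
    by (intro exI[of _ "{0}"]) auto
next
  case (Suc n)
  then obtain S where S: "finite S" "\<forall>x \<in> frac_ideal w k. \<exists>c \<in> S. x - c \<in> frac_ideal w (k + int n)"
    by blast
  obtain C where C: "finite C"
    "\<And>x. x \<in> frac_ideal w (k + int n) \<Longrightarrow> \<exists>!c. c \<in> C \<and> x - c \<in> frac_ideal w (k + int n + 1)"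
    by (rule frac_ideal_representatives[OF w, of "k + int n"]) (rule that)
  have "\<exists>e \<in> (\<lambda>(c, d). c + d) ` (S \<times> C). x - e \<in> frac_ideal w (k + int (Suc n))"
    if x: "x \<in> frac_ideal w k" for x
  proof -
    obtain c where c: "c \<in> S" "x - c \<in> frac_ideal w (k + int n)"
      using bspec[OF S(2) x] by (elim bexE)
    then obtain d where "d \<in> C" "x - c - d \<in> frac_ideal w (k + int n + 1)"
      using ex1_implies_ex[OF C(2)[OF c(2)]] by (elim exE conjE)
    then show ?thesis
      using c(1) by (intro bexI[of _ "c + d"]) (auto simp: algebra_simps)
  qed
  then show ?case
    using S(1) C(1) by (intro exI[of _ "(\<lambda>(c, d). c + d) ` (S \<times> C)"]) auto
qed

section \<open>Compactness of the ideals\<close>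

lemma closed_frac_ideal:
  assumes "uniformizer (w::'a::nonarch_local_field)"
  shows "closed (frac_ideal w k)"
proof -
  have "frac_ideal w k = cball 0 (real (residue_card TYPE('a)) powi - k)"
    using frac_ideal_iff[OF assms] by (auto simp: dist_vabs)
  then show ?thesis
    by simp
qed

lemma compact_frac_ideal:
  assumes w: "uniformizer (w::'a::nonarch_local_field)"
  shows "compact (frac_ideal w k)"
  unfolding compact_eq_totally_bounded complete_eq_closed
proof (intro conjI allI impI)
  fix e :: real assume e: "e > 0"
  let ?q = "real (residue_card TYPE('a))"
  have q: "?q \<ge> 2"
    using residue_card_ge_2[where 'a='a] by simp
  \<comment> \<open>This \<open>n\<close> makes the ideal of exponent \<open>k + n\<close> lie
    inside the ball of radius \<open>e\<close>, so the finite cover by its cosets shows total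
    boundedness.\<close>
  obtain n where "(1 / ?q) ^ n < e / ?q powi - k"
    using real_arch_pow_inv[of "e / ?q powi - k" "1 / ?q"] e q by auto
  then have n: "?q powi - (k + int n) < e"
    using q by (simp add: power_int_diff power_int_minus field_simps)
  obtain S where S: "finite S" "\<forall>x \<in> frac_ideal w k. \<exists>c \<in> S. x - c \<in> frac_ideal w (k + int n)"
    using frac_ideal_finite_cover[OF w] by blast
  have "frac_ideal w k \<subseteq> (\<Union>x\<in>S. ball x e)"
    using S(2) n by (fastforce simp: dist_commute[of _ "_::'a"] dist_vabs frac_ideal_iff[OF w])
  then show "\<exists>S. finite S \<and> frac_ideal w k \<subseteq> (\<Union>x\<in>S. ball x e)"
    using S(1) by blast
qed (rule closed_frac_ideal[OF w])

text \<open>The witness is \<open>z / x\<close>, where \<open>z\<close> has exponent at least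
  \<open>-1\<close> and \<open>\<psi> z \<noteq> 1\<close>; it is small enough because
  \<open>x\<close> is large.\<close>

lemma unramified_character_nontrivial:
  assumes w: "uniformizer (w::'a::nonarch_local_field)"
    and \<psi>: "unramified_character \<psi> w"
    and x: "x \<notin> frac_ideal w r"
  shows "\<exists>y \<in> frac_ideal w (- r). \<psi> (x * y) \<noteq> 1"
proof -
  let ?q = "real (residue_card TYPE('a))"
  have q: "?q \<ge> 2"
    using residue_card_ge_2[where 'a='a] by simp
  obtain z where z: "z \<in> frac_ideal w (- 1)" "\<psi> z \<noteq> 1"
    using \<psi> unfolding unramified_character_def by blast
  have x0: "x \<noteq> 0"
    using x q by (auto simp: frac_ideal_iff[OF w])
  \<comment> \<open>By discreteness at level \<open>r - 1\<close>, lying outside the ideal of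
    exponent \<open>r\<close> gains a full factor \<open>q\<close>, exactly what offsets
    \<open>vabs z \<le> q\<close>.\<close>
  have "?q powi (1 - r) \<le> vabs x"
    using vabs_less_imp_frac_ideal[OF w, of x "r - 1"] x by force
  moreover have "vabs z \<le> ?q"
    using z(1) by (simp add: frac_ideal_iff[OF w])
  moreover have "?q powi r * ?q powi (1 - r) = ?q"
    using q by (simp flip: power_int_add)
  ultimately have "vabs z \<le> ?q powi r * vabs x"
    using q mult_left_mono[of "?q powi (1 - r)" "vabs x" "?q powi r"] by simp
  then have "z / x \<in> frac_ideal w (- r)"
    using x0 by (simp add: frac_ideal_iff[OF w] vabs_divide field_simps)
  then show ?thesis
    using z(2) x0 by (intro bexI[of _ "z / x"]) auto
qed

section \<open>Subgroups of GSp(4)\<close>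

lemma vector_4:
  "(vector [a, b, c, d] :: 'a::zero^4) $ 1 = a"
  "(vector [a, b, c, d] :: 'a::zero^4) $ 2 = b"
  "(vector [a, b, c, d] :: 'a::zero^4) $ 3 = c"
  "(vector [a, b, c, d] :: 'a::zero^4) $ 4 = d"
  unfolding vector_def by simp_all

text \<open>These reduce an equation between explicit 4 by 4 matrices to its sixteen
  entries.\<close>

lemmas mat4_simps = vec_eq_iff forall_4 matrix_matrix_mult_def sum_4 transpose_def mat_def mat4_def
  vector_4

text \<open>Scalar matrices commute with all matrices, so the similitude factors multiply.\<close>

lemma GSp4_mult:
  fixes g h :: "'a::nonarch_local_field^4^4"
  assumes "g \<in> GSp4" "h \<in> GSp4"
  shows "g ** h \<in> GSp4"
proof -
  obtain l m where l: "l \<noteq> 0" "transpose g ** J4 ** g = mat l ** J4"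
    and m: "m \<noteq> 0" "transpose h ** J4 ** h = mat m ** J4"
    using assms unfolding GSp4_def by blast
  have comm: "A ** mat l = mat l ** A" for A :: "'a^4^4"
    by (simp add: mat4_simps mult.commute)
  have "transpose (g ** h) ** J4 ** (g ** h) = transpose h ** (transpose g ** J4 ** g) ** h"
    by (simp add: matrix_transpose_mul matrix_mul_assoc)
  also have "\<dots> = mat l ** (transpose h ** J4 ** h)"
    by (simp add: l(2) matrix_mul_assoc comm)
  also have "\<dots> = mat (l * m) ** J4"
    unfolding m(2) by (simp add: mat4_simps algebra_simps)
  finally show ?thesis
    using assms l(1) m(1) unfolding GSp4_def by (auto intro!: invertible_mult exI[of _ "l * m"])
qed

lemma nbar_mult: "nbar x ** nbar y = nbar (x + y)"
  by (simp add: nbar_def mat4_simps)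

text \<open>This entry is a continuous inverse of \<open>nbar\<close>; it gives injectivity and
  transfers closed sets and continuous functions from the field to the group.\<close>

lemma nbar_nth_3_2 [simp]: "nbar x $ 3 $ 2 = x"
  by (simp add: nbar_def mat4_simps)

lemma inj_nbar: "inj nbar"
  by (rule injI) (metis nbar_nth_3_2)

lemma nbar_0: "nbar 0 = mat 1"
  by (simp add: nbar_def mat4_simps)

lemma nbar_in_GSp4: "nbar x \<in> GSp4"
proof -
  have "invertible (nbar x)"
    unfolding invertible_def
    by (intro exI[of _ "nbar (- x)"]) (simp add: nbar_mult nbar_0)
  moreover have "transpose (nbar x) ** J4 ** nbar x = mat 1 ** J4"
    by (simp add: nbar_def J4_def mat4_simps)
  ultimately show ?thesis
    unfolding GSp4_def by (auto intro!: exI[of _ 1])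
qed

lemma a_prime_in_GSp4:
  assumes "t \<noteq> 0"
  shows "a_prime t \<in> GSp4"
proof -
  have "invertible (a_prime t)"
    unfolding invertible_def using assms
    by (intro exI[of _ "a_prime (inverse t)"]) (simp add: a_prime_def mat4_simps)
  moreover have "transpose (a_prime t) ** J4 ** a_prime t = mat t ** J4"
    by (simp add: a_prime_def J4_def mat4_simps)
  ultimately show ?thesis
    unfolding GSp4_def using assms by auto
qed

text \<open>Only this shape arises when \<open>n3 y\<close> is moved to the left; the Whittaker law
  applies to it once it is known to be symplectic.\<close>

lemma upper_unip_in_GSp4: "upper_unip x 0 y 0 y \<in> GSp4"
proof -
  have "invertible (upper_unip x 0 y 0 y)"
    unfolding invertible_def
    by (intro exI[of _ "upper_unip (- x) 0 (- y) 0 (- y)"]) (simp add: upper_unip_def mat4_simps)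
  moreover have "transpose (upper_unip x 0 y 0 y) ** J4 ** upper_unip x 0 y 0 y = mat 1 ** J4"
    by (simp add: upper_unip_def J4_def mat4_simps)
  ultimately show ?thesis
    unfolding GSp4_def by (auto intro!: exI[of _ 1])
qed

text \<open>Passing \<open>a_prime t\<close> scales only the upper right block, where
  \<open>\<psi>\<close> does not look. The relevant entry \<open>x * y\<close> is thus free of
  \<open>t\<close>, so one ideal of \<open>x\<close> serves all \<open>t\<close>.\<close>

lemma a_prime_nbar_n3:
  "a_prime t ** nbar x ** n3 y = upper_unip (x * y) 0 (t * y) 0 (t * y) ** (a_prime t ** nbar x)"
  by (simp add: a_prime_def nbar_def n3_def upper_unip_def mat4_simps algebra_simps)

lemma whittaker_vanishes:
  assumes w: "uniformizer w" and \<psi>: "unramified_character \<psi> w"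
    and W: "W \<in> whittaker_space \<psi>" and inv: "right_invariant (n3 ` frac_ideal w (- r)) W"
    and t: "t \<noteq> 0" and x: "x \<notin> frac_ideal w r"
  shows "W (a_prime t ** nbar x) = 0"
proof -
  obtain y where y: "y \<in> frac_ideal w (- r)" "\<psi> (x * y) \<noteq> 1"
    using unramified_character_nontrivial[OF w \<psi> x] by blast
  let ?g = "a_prime t ** nbar x"
  have g: "?g \<in> GSp4"
    using t by (intro GSp4_mult a_prime_in_GSp4 nbar_in_GSp4)
  have "W ?g = W (?g ** n3 y)"
    using inv g y(1) unfolding right_invariant_def by simp
  \<comment> \<open>The summand 0 is the second parameter of \<open>upper_unip\<close>, kept to
    match the transformation law.\<close>
  also have "\<dots> = \<psi> (x * y + 0) * W ?g"
    unfolding a_prime_nbar_n3 using W g upper_unip_in_GSp4 unfolding whittaker_space_def by blast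
  finally show ?thesis
    using y(2) by simp
qed

section \<open>Integration over the lower unipotent group\<close>

text \<open>Right multiplication by \<open>nbar x\<close> adds \<open>x\<close> times column 3 to
  column 2, so every entry is Lipschitz in \<open>x\<close>.\<close>

lemma continuous_nbar_translate:
  "continuous_on UNIV (\<lambda>x. (g :: 'a::nonarch_local_field^4^4) ** nbar x)"
proof -
  have dist_le: "dist ((g ** nbar x) $ i $ j) ((g ** nbar y) $ i $ j) \<le> vabs (g $ i $ 3) * dist x y"
    for x y i j
  proof -
    have "(g ** nbar x) $ i $ j - (g ** nbar y) $ i $ j = (if j = 2 then g $ i $ 3 * (x - y) else 0)"
      using exhaust_4[of j] by (auto simp: nbar_def mat4_simps algebra_simps)
    then show ?thesis
      by (simp add: dist_vabs vabs_mult)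
  qed
  have entry: "continuous_on UNIV (\<lambda>x. (g ** nbar x) $ i $ j)" for i j
    by (rule lipschitz_on_continuous_on[of "vabs (g $ i $ 3)"]) (simp add: lipschitz_on_def dist_le)
  have "continuous_on UNIV (\<lambda>x. \<chi> i j. (g ** nbar x) $ i $ j)"
    by (intro continuous_on_vec_lambda entry)
  then show ?thesis
    by simp
qed

lemma continuous_nbar: "continuous_on UNIV nbar"
  using continuous_nbar_translate[of "mat 1"] by simp

lemma smooth_nbar_continuous:
  assumes W: "smooth_on_GSp4 W" and g: "g \<in> GSp4"
  shows "continuous_on UNIV (\<lambda>x. W (g ** nbar x))"
proof (rule continuous_at_imp_continuous_on, rule ballI)
  fix x
  have "g ** nbar x \<in> GSp4"
    using g by (intro GSp4_mult nbar_in_GSp4)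
  then obtain U where U: "open U" "g ** nbar x \<in> U" "\<forall>h \<in> U \<inter> GSp4. W h = W (g ** nbar x)"
    using W unfolding smooth_on_GSp4_def by blast
  have "((\<lambda>y. g ** nbar y) \<longlongrightarrow> g ** nbar x) (at x)"
    using continuous_nbar_translate[of g] by (simp add: continuous_on_def)
  then have "\<forall>\<^sub>F y in at x. g ** nbar y \<in> U"
    using U(1,2) by (rule topological_tendstoD)
  then have "\<forall>\<^sub>F y in at x. W (g ** nbar y) = W (g ** nbar x)"
    by (rule eventually_mono) (simp add: U(3) GSp4_mult g nbar_in_GSp4)
  then show "isCont (\<lambda>y. W (g ** nbar y)) x"
    unfolding continuous_at by (rule tendsto_eventually)
qed

text \<open>The image is the trace on \<open>range nbar\<close> of a closed set of matrices, the
  preimage of \<open>K\<close> under the entry in row 3, column 2.\<close>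

lemma sets_nbar_closed:
  assumes \<mu>: "haar_measure (range nbar) (**) \<mu>" and K: "closed (K :: 'a::nonarch_local_field set)"
  shows "nbar ` K \<in> sets \<mu>"
proof -
  have "closed ((\<lambda>A :: 'a^4^4. A $ 3 $ 2) -` K)"
    by (intro closed_vimage K continuous_on_component continuous_on_id)
  then have "range nbar \<inter> (\<lambda>A. A $ 3 $ 2) -` K \<in> sets (restrict_space borel (range nbar))"
    by (auto simp: sets_restrict_space)
  also have "range nbar \<inter> (\<lambda>A. A $ 3 $ 2) -` K = nbar ` K"
    by auto
  finally show ?thesis
    using \<mu> by (simp add: haar_measure_def)
qed

section \<open>Volumes of the ideals\<close>

lemma closed_translate_frac_ideal:
  assumes w: "uniformizer (w::'a::nonarch_local_field)"
  shows "closed ((+) c ` frac_ideal w k)"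
proof -
  have "x \<in> (+) c ` frac_ideal w k \<longleftrightarrow> x - c \<in> frac_ideal w k" for x
    by (auto intro!: image_eqI[of _ _ "x - c"])
  then have "(+) c ` frac_ideal w k = cball c (real (residue_card TYPE('a)) powi - k)"
    by (auto simp: frac_ideal_iff[OF w] dist_commute[of c] dist_vabs[of _ c])
  then show ?thesis
    by simp
qed

text \<open>The larger ideal is a disjoint union of \<open>q\<close> cosets of the smaller one.
  Under \<open>nbar\<close> they become left translates, which have equal measure.\<close>

lemma emeasure_nbar_frac_ideal_step:
  fixes w :: "'a::nonarch_local_field"
  assumes \<mu>: "haar_measure (range nbar) (**) \<mu>" and w: "uniformizer w"
  shows "emeasure \<mu> (nbar ` frac_ideal w k) =
    of_nat (residue_card TYPE('a)) * emeasure \<mu> (nbar ` frac_ideal w (k + 1))"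
proof -
  obtain C where C: "C \<subseteq> frac_ideal w k" "finite C" "card C = residue_card TYPE('a)"
    and ex1: "\<And>x. x \<in> frac_ideal w k \<Longrightarrow> \<exists>!c. c \<in> C \<and> x - c \<in> frac_ideal w (k + 1)"
    by (rule frac_ideal_representatives[OF w, of k]) (rule that)
  define S where "S = (\<lambda>c. nbar ` ((+) c ` frac_ideal w (k + 1)))"
  have S_eq: "S c = (**) (nbar c) ` (nbar ` frac_ideal w (k + 1))" for c
    by (auto simp: S_def image_image nbar_mult)
  have in_ideal: "c + y \<in> frac_ideal w k" if "c \<in> C" "y \<in> frac_ideal w (k + 1)" for c y
    using that C(1) frac_ideal_mono[OF w, of k "k + 1"] by (auto intro!: frac_ideal_add[OF w])
  have emeasure_S: "emeasure \<mu> (S c) = emeasure \<mu> (nbar ` frac_ideal w (k + 1))" for c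
  proof -
    have "\<forall>g \<in> range nbar. \<forall>A \<in> sets \<mu>. emeasure \<mu> ((**) g ` A) = emeasure \<mu> A"
      using \<mu> by (simp add: haar_measure_def)
    then show ?thesis
      unfolding S_eq by (simp add: sets_nbar_closed[OF \<mu> closed_frac_ideal[OF w]])
  qed
  have "S c \<in> sets \<mu>" for c
    unfolding S_def by (intro sets_nbar_closed[OF \<mu>] closed_translate_frac_ideal[OF w])
  moreover have "disjoint_family_on S C"
  proof -
    \<comment> \<open>Both \<open>c\<close> and \<open>d\<close> represent the element
      \<open>c + y\<close>, so uniqueness identifies them.\<close>
    have unique: "c = d" if "c \<in> C" "d \<in> C" "y \<in> frac_ideal w (k + 1)" "z \<in> frac_ideal w (k + 1)"
      "c + y = d + z" for c d y z
    proof -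
      have "c + y - c = y" "c + y - d = z"
        using that(5) by (simp_all add: algebra_simps)
      then have c: "c \<in> C \<and> c + y - c \<in> frac_ideal w (k + 1)"
        and d: "d \<in> C \<and> c + y - d \<in> frac_ideal w (k + 1)"
        using that(1-4) by simp_all
      show ?thesis
        using the1_equality[OF ex1[OF in_ideal[OF that(1,3)]] c]
          the1_equality[OF ex1[OF in_ideal[OF that(1,3)]] d] by (rule trans[OF sym])
    qed
    show ?thesis
      unfolding disjoint_family_on_def
    proof (intro ballI impI equals0I)
      fix c d A
      assume "c \<in> C" "d \<in> C" "c \<noteq> d" "A \<in> S c \<inter> S d"
      moreover from this obtain y z where "y \<in> frac_ideal w (k + 1)" "z \<in> frac_ideal w (k + 1)"
        "nbar (c + y) = nbar (d + z)"
        by (auto simp: S_def)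
      ultimately show False
        using unique[of c d y z] by (simp add: inj_eq[OF inj_nbar])
    qed
  qed
  moreover have "nbar ` frac_ideal w k = (\<Union>c\<in>C. S c)"
  proof -
    have "x \<in> (\<Union>c\<in>C. (+) c ` frac_ideal w (k + 1))" if x: "x \<in> frac_ideal w k" for x
    proof -
      obtain c where "c \<in> C" "x - c \<in> frac_ideal w (k + 1)"
        using ex1_implies_ex[OF ex1[OF x]] by (elim exE conjE)
      then show ?thesis
        by (intro UN_I[of c] image_eqI[of _ _ "x - c"]) simp_all
    qed
    then have "frac_ideal w k = (\<Union>c\<in>C. (+) c ` frac_ideal w (k + 1))"
      using in_ideal by blast
    then show ?thesis
      by (simp add: S_def image_UN)
  qed
  ultimately have "emeasure \<mu> (nbar ` frac_ideal w k) = (\<Sum>c\<in>C. emeasure \<mu> (S c))"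
    using C(2) by (simp add: sum_emeasure image_subset_iff)
  then show ?thesis
    by (simp add: emeasure_S C(3))
qed

text \<open>Induction in both directions from \<open>k = 0\<close>, where \<open>vol\<close>
  applies. Going up cancels the finite nonzero factor \<open>q\<close> in \<open>ennreal\<close>;
  going down multiplies by it.\<close>

lemma emeasure_nbar_frac_ideal:
  fixes w :: "'a::nonarch_local_field"
  assumes \<mu>: "haar_measure (range nbar) (**) \<mu>" and w: "uniformizer w"
    and vol: "emeasure \<mu> (nbar ` int_ring) = 1"
  shows "emeasure \<mu> (nbar ` frac_ideal w k) = ennreal (real (residue_card TYPE('a)) powi - k)"
proof (induction k rule: int_induct[of _ 0])
  case base
  then show ?case
    by (simp add: frac_ideal_0 vol)
next
  let ?q = "real (residue_card TYPE('a))"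
  have q: "?q > 0"
    using residue_card_ge_2[where 'a='a] by simp
  have of_nat_q: "of_nat (residue_card TYPE('a)) = ennreal ?q"
    by (simp add: ennreal_of_nat_eq_real_of_nat)
  have step: "ennreal (?q powi - k) = of_nat (residue_card TYPE('a)) * ennreal (?q powi - (k + 1))" for k
  proof -
    have "?q powi - k = ?q powi 1 * ?q powi - (k + 1)"
      unfolding power_int_add[symmetric, OF disjI1[OF less_imp_neq[OF q, symmetric]]] by simp
    then show ?thesis
      using q by (simp add: of_nat_q ennreal_mult)
  qed
  case (step1 k)
  have "of_nat (residue_card TYPE('a)) * emeasure \<mu> (nbar ` frac_ideal w (k + 1)) =
      of_nat (residue_card TYPE('a)) * ennreal (?q powi - (k + 1))"
    using step1(2) step[of k] emeasure_nbar_frac_ideal_step[OF \<mu> w, of k] by simp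
  then show ?case
    using q by (simp add: ennreal_mult_cancel_left of_nat_q)
next
  let ?q = "real (residue_card TYPE('a))"
  have q: "?q > 0"
    using residue_card_ge_2[where 'a='a] by simp
  case (step2 k)
  have "?q powi - (k - 1) = ?q powi 1 * ?q powi - k"
    unfolding power_int_add[symmetric, OF disjI1[OF less_imp_neq[OF q, symmetric]]] by simp
  then show ?case
    using step2(2) emeasure_nbar_frac_ideal_step[OF \<mu> w, of "k - 1"] q
    by (simp add: ennreal_of_nat_eq_real_of_nat ennreal_mult)
qed

text \<open>The ideal is compact, so the integrand is bounded on it and its image under
  \<open>nbar\<close> has finite measure.\<close>

lemma set_integrable_nbar_frac_ideal:
  assumes \<mu>: "haar_measure (range nbar) (**) \<mu>" and w: "uniformizer w"
    and W: "smooth_on_GSp4 W" and g: "g \<in> GSp4"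
  shows "set_integrable \<mu> (nbar ` frac_ideal w k) (\<lambda>n. right_transl n W g)"
proof -
  let ?f = "\<lambda>x. W (g ** nbar x)"
  have cont: "continuous_on UNIV ?f"
    using W g by (rule smooth_nbar_continuous)
  \<comment> \<open>Measurability for \<open>\<mu>\<close> concerns functions of the matrix, so
    continuity in the parameter is carried over by the entry that recovers it.\<close>
  have "continuous_on (range nbar) (\<lambda>n. ?f (n $ 3 $ 2))"
    by (rule continuous_on_compose2[OF cont]) (auto intro!: continuous_on_component continuous_on_id)
  then have "continuous_on (range nbar) (\<lambda>n. W (g ** n))"
    by (rule continuous_on_eq) auto
  then have "(\<lambda>n. W (g ** n)) \<in> borel_measurable (restrict_space borel (range nbar))"
    by (rule borel_measurable_continuous_on_restrict)
  moreover have sets_\<mu>: "sets \<mu> = sets (restrict_space borel (range nbar))"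
    using \<mu> by (simp add: haar_measure_def)
  ultimately have meas: "(\<lambda>n. W (g ** n)) \<in> borel_measurable \<mu>"
    by (simp cong: measurable_cong_sets)
  have "compact (?f ` frac_ideal w k)"
    using cont compact_frac_ideal[OF w]
    by (intro compact_continuous_image) (auto intro: continuous_on_subset)
  then have "bounded (?f ` frac_ideal w k)"
    by (rule compact_imp_bounded)
  then obtain B where B: "\<And>x. x \<in> frac_ideal w k \<Longrightarrow> norm (?f x) \<le> B"
    by (auto simp: bounded_iff)
  have "compact (nbar ` frac_ideal w k)"
    using continuous_nbar compact_frac_ideal[OF w]
    by (intro compact_continuous_image) (auto intro: continuous_on_subset)
  then have finite: "emeasure \<mu> (nbar ` frac_ideal w k) < \<infinity>"
    using \<mu> by (simp add: haar_measure_def image_mono)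
  show ?thesis
    unfolding set_integrable_def right_transl_def
    using sets_nbar_closed[OF \<mu> closed_frac_ideal[OF w]] meas finite
    by (rule integrableI_bounded_set_indicator[where B = B]) (auto simp: B)
qed

text \<open>A divergent Bochner integral has value 0, so equality of values alone would not compare
  convergence. The equivalences state that both sides converge together.\<close>

theorem proposition5p1:
  fixes \<psi> :: "'f::nonarch_local_field \<Rightarrow> complex"
    and w :: 'f
    and \<mu> :: "('f^4^4) measure"
    and \<nu> :: "'f measure"
    and W :: "'f^4^4 \<Rightarrow> complex"
    and r :: int
    and s :: complex
  assumes "uniformizer w"
    and "unramified_character \<psi> w"
    and "haar_measure (range nbar) (**) \<mu>"
    and "emeasure \<mu> (nbar ` int_ring) = 1"
    and "haar_measure (- {0}) (*) \<nu>"
    and "emeasure \<nu> int_units = 1"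
    and "W \<in> whittaker_space \<psi>"
    and "right_invariant (n3 ` frac_ideal w (- r)) W"
  shows "(\<forall>g \<in> GSp4. set_integrable \<mu> (nbar ` frac_ideal w r) (\<lambda>n. right_transl n W g)) \<and>
    (Z_converges \<mu> \<nu> s W \<longleftrightarrow>
       Xi_converges \<nu> s (transl_integral \<mu> (nbar ` frac_ideal w r) W)) \<and>
    Z \<mu> \<nu> s W = Xi \<nu> s (transl_integral \<mu> (nbar ` frac_ideal w r) W) \<and>
    (right_invariant (nbar ` frac_ideal w r) W \<longrightarrow>
       (Z_converges \<mu> \<nu> s W \<longleftrightarrow> Xi_converges \<nu> s W) \<and>
       Z \<mu> \<nu> s W = of_nat (residue_card TYPE('f)) powi (- r) * Xi \<nu> s W)"
proof -
  let ?P = "nbar ` frac_ideal w r"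
  let ?q = "residue_card TYPE('f)"
  \<comment> \<open>\<open>\<nu>\<close> lives on the nonzero elements, so identities at
    \<open>a_prime t\<close> with \<open>t \<noteq> 0\<close> suffice for the outer
    integral.\<close>
  have space_\<nu>: "t \<noteq> 0" if "t \<in> space \<nu>" for t
    using assms(5) that by (auto simp: haar_measure_def)
  have "smooth_on_GSp4 W"
    using assms(7) by (simp add: whittaker_space_def)
  then have integrable: "set_integrable \<mu> ?P (\<lambda>n. right_transl n W g)" if "g \<in> GSp4" for g
    using set_integrable_nbar_frac_ideal[OF assms(3,1)] that by blast
  \<comment> \<open>By the vanishing, the two integrands agree pointwise once extended by 0.
    Integrability and value transfer with no estimate.\<close>
  have restrict: "indicator (range nbar) n *\<^sub>R right_transl n W (a_prime t) =
      indicator ?P n *\<^sub>R right_transl n W (a_prime t)" if "t \<noteq> 0" for t n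
    using whittaker_vanishes[OF assms(1,2,7,8) that]
    by (auto simp: indicator_def right_transl_def inj_image_mem_iff[OF inj_nbar])
  \<comment> \<open>The inner half of \<open>Z_converges\<close> therefore always holds, leaving
    only the outer integral.\<close>
  have converges: "set_integrable \<mu> (range nbar) (\<lambda>n. right_transl n W (a_prime t))" if "t \<noteq> 0" for t
    using integrable[OF a_prime_in_GSp4[OF that]] by (simp add: set_integrable_def restrict that)
  have Xi_eq: "Xi_integrand s (transl_integral \<mu> (range nbar) W) t =
      Xi_integrand s (transl_integral \<mu> ?P W) t" if "t \<in> space \<nu>" for t
    unfolding Xi_integrand_def transl_integral_def set_lebesgue_integral_def
    by (simp add: restrict[OF space_\<nu>[OF that]])
  have "integrable \<nu> (Xi_integrand s (transl_integral \<mu> (range nbar) W)) \<longleftrightarrow>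
      integrable \<nu> (Xi_integrand s (transl_integral \<mu> ?P W))"
    by (rule Bochner_Integration.integrable_cong[OF refl Xi_eq])
  then have Z_converges_iff: "Z_converges \<mu> \<nu> s W \<longleftrightarrow> Xi_converges \<nu> s (transl_integral \<mu> ?P W)"
    by (simp add: Z_converges_def Xi_converges_def converges)
  have Z_eq: "Z \<mu> \<nu> s W = Xi \<nu> s (transl_integral \<mu> ?P W)"
    unfolding Z_def Xi_def by (rule Bochner_Integration.integral_cong[OF refl Xi_eq])
  have "(Z_converges \<mu> \<nu> s W \<longleftrightarrow> Xi_converges \<nu> s W) \<and>
      Z \<mu> \<nu> s W = of_nat ?q powi (- r) * Xi \<nu> s W"
    if inv: "right_invariant ?P W"
  proof -
    let ?c = "of_nat ?q powi (- r) :: complex"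
    have c: "?c \<noteq> 0"
      using residue_card_ge_2[where 'a='f] by simp
    have vol: "emeasure \<mu> ?P = ennreal (real ?q powi - r)"
      by (rule emeasure_nbar_frac_ideal[OF assms(3,1,4)])
    then have "measure \<mu> ?P = real ?q powi - r"
      by (simp add: measure_def)
    then have measure: "of_real (measure \<mu> ?P) = ?c"
      by simp
    \<comment> \<open>Invariance makes the inner integrand constant on \<open>?P\<close>, so the
      integral is the volume times that constant.\<close>
    have "transl_integral \<mu> ?P W (a_prime t) = ?c * W (a_prime t)" if "t \<noteq> 0" for t
    proof -
      have "transl_integral \<mu> ?P W (a_prime t) = (LINT n:?P|\<mu>. W (a_prime t))"
        unfolding transl_integral_def right_transl_def
        using inv a_prime_in_GSp4[OF that]
        by (intro set_lebesgue_integral_cong sets_nbar_closed[OF assms(3)] closed_frac_ideal assms(1))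
          (auto simp: right_invariant_def)
      also have "\<dots> = measure \<mu> ?P *\<^sub>R W (a_prime t)"
        by (rule set_integral_const)
          (simp_all add: vol sets_nbar_closed[OF assms(3)] closed_frac_ideal assms(1))
      finally show ?thesis
        by (simp add: scaleR_conv_of_real measure)
    qed
    then have scale: "Xi_integrand s (transl_integral \<mu> ?P W) t = ?c * Xi_integrand s W t"
      if "t \<in> space \<nu>" for t
      using space_\<nu>[OF that] by (simp add: Xi_integrand_def)
    have "integrable \<nu> (Xi_integrand s (transl_integral \<mu> ?P W)) \<longleftrightarrow>
        integrable \<nu> (\<lambda>t. ?c * Xi_integrand s W t)"
      by (rule Bochner_Integration.integrable_cong[OF refl scale])
    \<comment> \<open>As \<open>?c\<close> is nonzero, multiplying by its inverse gives the
      direction from the scaled integrand back to the original.\<close>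
    moreover have "integrable \<nu> (\<lambda>t. ?c * Xi_integrand s W t) \<longleftrightarrow> integrable \<nu> (Xi_integrand s W)"
      using c integrable_mult_right[of "inverse ?c" \<nu> "\<lambda>t. ?c * Xi_integrand s W t"]
      by (auto simp: mult.assoc[symmetric] simp del: power_int_minus)
    ultimately have "Xi_converges \<nu> s (transl_integral \<mu> ?P W) \<longleftrightarrow> Xi_converges \<nu> s W"
      by (simp only: Xi_converges_def)
    moreover have "Xi \<nu> s (transl_integral \<mu> ?P W) = (LINT t|\<nu>. ?c * Xi_integrand s W t)"
      unfolding Xi_def by (rule Bochner_Integration.integral_cong[OF refl scale])
    ultimately show ?thesis
      by (simp add: Z_converges_iff Z_eq Xi_def)
  qed
  then show ?thesis
    by (intro conjI ballI integrable Z_converges_iff Z_eq impI) simp_all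
qed

end
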